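(* Let $f:\mathbb{R}^n\to\mathbb{R}$ be twice continuously differentiable and let $F(v):=f(v\odot v)$ for $v\in\mathbb{R}^n$. Let $x^*\in\mathbb{R}^n$ with $x^*\ge 0$, and let $v^*\in\mathbb{R}^n$ satisfy $v^*_i=\pm\sqrt{x^*_i}$ for $i=1,\dots,n$ (with any choice of signs). Then $x^*$ satisfies the weak second-order necessary (weak 2N) conditions for the problem $\min_x f(x)$ s.t. $x\ge 0$ if and only if $v^*$ satisfies the second-order necessary (2N) conditions for the unconstrained problem $\min_v F(v)$.
   Context: $v\odot v=(v_i^2)_{i=1}^n$ is the componentwise (Hadamard) product; inequalities between vectors are componentwise. Problem (BC): $\min_x f(x)$ s.t. $x\ge 0$. Problem (DSS): $\min_v F(v)=f(v\odot v)$, unconstrained. A point $x^*$ satisfies first-order necessary (1N) conditions for (BC) if $x^*\ge0$, $\nabla f(x^* )\ge 0$, and $x_i^*[\nabla f(x^* )]_i=0$ for all $i$. For such $x^*$ define $\mathcal{I}=\{i: x_i^*>0\}$, $\mathcal{A}=\{i: x_i^*=0,\ [\nabla f(x^* )]_i>0\}$, $\mathcal{D}=\{i: x_i^*=0,\ [\nabla f(x^* )]_i=0\}$. $x^*$ satisfies weak second-order necessary (weak 2N) conditions for (BC) if it satisfies the 1N conditions and $w^T\nabla^2 f(x^* )w\ge 0$ for all $w\in\mathbb{R}^n$ with $w_i=0$ for $i\in\mathcal{A}\cup\mathcal{D}$. $v^*$ satisfies second-order necessary (2N) conditions for (DSS) if $\nabla F(v^* )=0$ and $\nabla^2F(v^*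 )\succeq 0$. *)

theory Defs
  imports "HOL-Analysis.Analysis"
begin

definition gradient :: "(real^'n \<Rightarrow> real) \<Rightarrow> real^'n \<Rightarrow> real^'n" where
  "gradient f x = (\<chi> i. frechet_derivative f (at x) (axis i 1))"

definition hessian :: "(real^'n \<Rightarrow> real) \<Rightarrow> real^'n \<Rightarrow> real^'n^'n" where
  "hessian f x = jacobian (gradient f) (at x)"

(* Values of frechet_derivative are unspecified at points of non-differentiability, so
   differentiability of f and of its gradient is required separately; continuity of f and
   of the gradient follows. *)
definition twice_cont_differentiable :: "(real^'n \<Rightarrow> real) \<Rightarrow> bool" where
  "twice_cont_differentiable f \<longleftrightarrow>
     (\<forall>x. f differentiable (at x)) \<and>
     (\<forall>x. gradient f differentiable (at x)) \<and>
     continuous_on UNIV (hessian f)"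

(* Only applied to Hessians of twice continuously differentiable functions, which are
   symmetric by Schwarz's theorem; symmetry is therefore not part of the definition. *)
definition pos_semidef :: "real^'n^'n \<Rightarrow> bool" where
  "pos_semidef H \<longleftrightarrow> (\<forall>w. 0 \<le> w \<bullet> (H *v w))"

text \<open>
  The bound-constrained problem: minimise \<open>f x\<close> subject to \<open>x \<ge> 0\<close>.
  The order on \<open>real^'n\<close> is the componentwise one.
\<close>

definition first_order_necessary_BC :: "(real^'n \<Rightarrow> real) \<Rightarrow> real^'n \<Rightarrow> bool" where
  "first_order_necessary_BC f x \<longleftrightarrow>
     0 \<le> x \<and> 0 \<le> gradient f x \<and> (\<forall>i. x $ i * gradient f x $ i = 0)"

definition active_set :: "(real^'n \<Rightarrow> real) \<Rightarrow> real^'n \<Rightarrow> 'n set" where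
  "active_set f x = {i. x $ i = 0 \<and> gradient f x $ i > 0}"

definition degenerate_set :: "(real^'n \<Rightarrow> real) \<Rightarrow> real^'n \<Rightarrow> 'n set" where
  "degenerate_set f x = {i. x $ i = 0 \<and> gradient f x $ i = 0}"

definition weak_second_order_necessary_BC :: "(real^'n \<Rightarrow> real) \<Rightarrow> real^'n \<Rightarrow> bool" where
  "weak_second_order_necessary_BC f x \<longleftrightarrow>
     first_order_necessary_BC f x \<and>
     (\<forall>w. (\<forall>i \<in> active_set f x \<union> degenerate_set f x. w $ i = 0)
        \<longrightarrow> 0 \<le> w \<bullet> (hessian f x *v w))"

text \<open>
  The unconstrained problem: minimise \<open>F v = f (v \<odot> v)\<close>.
  Multiplication on \<open>real^'n\<close> is the componentwise (Hadamard) product.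
\<close>

definition DSS_objective :: "(real^'n \<Rightarrow> real) \<Rightarrow> real^'n \<Rightarrow> real" where
  "DSS_objective f v = f (v * v)"

definition second_order_necessary_unconstrained :: "(real^'n \<Rightarrow> real) \<Rightarrow> real^'n \<Rightarrow> bool" where
  "second_order_necessary_unconstrained F v \<longleftrightarrow>
     gradient F v = 0 \<and> pos_semidef (hessian F v)"

end

theory Submission
  imports Defs
begin

text \<open>
  Everything follows from one identity for the quadratic form of the Hessian of the lifted objective.
  By the chain rule, the gradient of \<open>F v = f (v \<odot> v)\<close> is \<open>2 v \<odot> g\<close>, where \<open>g\<close> is the gradient
  of \<open>f\<close> at \<open>x = v \<odot> v\<close>. The product rule and the chain rule, applied to this formula, give
  \<open>w\<^sup>T \<nabla>\<^sup>2F(v) w = 2 \<Sum>\<^sub>i g\<^sub>i w\<^sub>i\<^sup>2 + 4 (v \<odot> w)\<^sup>T \<nabla>\<^sup>2f(x) (v \<odot> w)\<close>.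

  If \<open>x\<close> satisfies the weak conditions, then the first summand is nonnegative because \<open>g \<ge> 0\<close>, and
  the second is nonnegative because \<open>v \<odot> w\<close> vanishes wherever \<open>x\<close> does. In the other direction two
  kinds of test vectors separate the summands. If \<open>x\<^sub>i = 0\<close>, the \<open>i\<close>-th unit vector annihilates the
  second summand and gives \<open>g\<^sub>i \<ge> 0\<close>. If \<open>u\<close> vanishes wherever \<open>x\<close> does, then \<open>u = v \<odot> w\<close> with
  \<open>w = u / v\<close> supported on \<open>x > 0\<close>; there \<open>g\<close> vanishes by stationarity, so only the second summand
  is left, and it is \<open>4 u\<^sup>T \<nabla>\<^sup>2f(x) u\<close>.
\<close>

text \<open>
  In finite dimension bilinearity already implies boundedness, so the Hadamard product obeys the
  product rule for derivatives.
\<close>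

lemma bounded_bilinear_vec_times:
  "bounded_bilinear ((*) :: real^'n \<Rightarrow> real^'n \<Rightarrow> real^'n)"
  by (subst bilinear_conv_bounded_bilinear [symmetric])
     (auto simp: bilinear_def vec_eq_iff algebra_simps intro!: linearI)

lemmas has_derivative_vec_times =
  bounded_bilinear.FDERIV [OF bounded_bilinear_vec_times]

lemma has_derivative_hadamard_square:
  fixes v :: "real^'n"
  shows "((\<lambda>v. v * v) has_derivative (\<lambda>h. 2 *\<^sub>R (v * h))) (at v)"
proof -
  have "((\<lambda>v. v * v) has_derivative (\<lambda>h. v * h + h * v)) (at v)"
    by (rule has_derivative_vec_times) (rule has_derivative_ident)+
  also have "(\<lambda>h. v * h + h * v) = (\<lambda>h. 2 *\<^sub>R (v * h))"
    by (auto simp: vec_eq_iff)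
  finally show ?thesis .
qed

lemma gradient_eqI:
  fixes f :: "real^'n \<Rightarrow> real"
  assumes "(f has_derivative (\<lambda>h. g \<bullet> h)) (at x)"
  shows "gradient f x = g"
  using frechet_derivative_at [OF assms, symmetric]
  by (simp add: gradient_def vec_eq_iff inner_axis)

lemma has_derivative_gradient:
  fixes f :: "real^'n \<Rightarrow> real"
  assumes "f differentiable (at x)"
  shows "(f has_derivative (\<lambda>h. gradient f x \<bullet> h)) (at x)"
proof -
  let ?D = "frechet_derivative f (at x)"
  have D: "(f has_derivative ?D) (at x)"
    using assms frechet_derivative_works by blast
  then have lin: "linear ?D"
    by (rule has_derivative_linear)
  have "?D h = gradient f x \<bullet> h" for h
  proof -
    have "?D h = ?D (\<Sum>i\<in>UNIV. (h $ i) *\<^sub>R axis i 1)"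
      using basis_expansion [of h] by (simp add: scalar_mult_eq_scaleR)
    also have "\<dots> = (\<Sum>i\<in>UNIV. (h $ i) *\<^sub>R ?D (axis i 1))"
      by (simp add: linear_sum [OF lin] linear_scale [OF lin])
    also have "\<dots> = gradient f x \<bullet> h"
      by (simp add: gradient_def inner_vec_def mult.commute)
    finally show ?thesis .
  qed
  then have "?D = (\<lambda>h. gradient f x \<bullet> h)" ..
  then show ?thesis
    using D by metis
qed

lemma has_derivative_hessian:
  fixes f :: "real^'n \<Rightarrow> real"
  assumes "gradient f differentiable (at x)"
  shows "(gradient f has_derivative (\<lambda>h. hessian f x *v h)) (at x)"
  using assms unfolding hessian_def by (rule jacobian_works [THEN iffD1])

lemma hessian_mult_eqI:
  fixes f :: "real^'n \<Rightarrow> real"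
  assumes "(gradient f has_derivative D) (at x)"
  shows "hessian f x *v h = D h"
  using has_derivative_unique [OF has_derivative_hessian assms] assms
  by (metis differentiableI)

lemma gradient_DSS_objective:
  fixes f :: "real^'n \<Rightarrow> real"
  assumes "f differentiable (at (v * v))"
  shows "gradient (DSS_objective f) v = 2 *\<^sub>R (v * gradient f (v * v))"
proof (rule gradient_eqI)
  have "(DSS_objective f has_derivative (\<lambda>h. gradient f (v * v) \<bullet> (2 *\<^sub>R (v * h)))) (at v)"
    unfolding DSS_objective_def
    by (rule has_derivative_compose [OF has_derivative_hadamard_square
          has_derivative_gradient [OF assms]])
  also have "(\<lambda>h. gradient f (v * v) \<bullet> (2 *\<^sub>R (v * h))) =
      (\<lambda>h. (2 *\<^sub>R (v * gradient f (v * v))) \<bullet> h)"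
    by (auto simp: inner_vec_def sum_distrib_left algebra_simps intro!: sum.cong)
  finally show "(DSS_objective f has_derivative
      (\<lambda>h. (2 *\<^sub>R (v * gradient f (v * v))) \<bullet> h)) (at v)" .
qed

text \<open>
  The gradient of the lifted objective is a product of two functions of \<open>v\<close>. Differentiating the
  factor \<open>v\<close> produces the diagonal term, which sees the sign of the gradient of \<open>f\<close>; differentiating
  the other factor produces the Hessian of \<open>f\<close>, scaled by \<open>v\<close> on both sides.
\<close>

lemma hessian_DSS_objective_quadratic_form:
  fixes f :: "real^'n \<Rightarrow> real"
  assumes diff: "\<And>x. f differentiable (at x)"
    and diff2: "gradient f differentiable (at (v * v))"
  shows "w \<bullet> (hessian (DSS_objective f) v *v w) =
    2 * (\<Sum>i\<in>UNIV. gradient f (v * v) $ i * (w $ i)\<^sup>2) +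
    4 * ((v * w) \<bullet> (hessian f (v * v) *v (v * w)))"
proof -
  let ?g = "gradient f (v * v)" and ?H = "hessian f (v * v)"
  have "((\<lambda>v. gradient f (v * v)) has_derivative (\<lambda>h. ?H *v (2 *\<^sub>R (v * h)))) (at v)"
    by (rule has_derivative_compose [OF has_derivative_hadamard_square
          has_derivative_hessian [OF diff2]])
  then have "((\<lambda>v. 2 *\<^sub>R (v * gradient f (v * v))) has_derivative
      (\<lambda>h. 2 *\<^sub>R (v * (?H *v (2 *\<^sub>R (v * h))) + h * ?g))) (at v)"
    by (intro has_derivative_scaleR_right has_derivative_vec_times has_derivative_ident)
  also have "(\<lambda>v. 2 *\<^sub>R (v * gradient f (v * v))) = gradient (DSS_objective f)"
    using gradient_DSS_objective [OF diff] by (rule ext [OF sym])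
  finally have "(gradient (DSS_objective f) has_derivative
      (\<lambda>h. 2 *\<^sub>R (v * (?H *v (2 *\<^sub>R (v * h))) + h * ?g))) (at v)" .
  then have "hessian (DSS_objective f) v *v w = 2 *\<^sub>R (v * (?H *v (2 *\<^sub>R (v * w))) + w * ?g)"
    by (rule hessian_mult_eqI)
  also have "\<dots> = 4 *\<^sub>R (v * (?H *v (v * w))) + 2 *\<^sub>R (w * ?g)"
    by (simp add: vec_eq_iff matrix_vector_mult_scaleR)
  also have "w \<bullet> \<dots> = 2 * (\<Sum>i\<in>UNIV. ?g $ i * (w $ i)\<^sup>2) + 4 * ((v * w) \<bullet> (?H *v (v * w)))"
    by (simp add: inner_vec_def inner_add_right power2_eq_square sum_distrib_left sum.distrib
        distrib_left ac_simps)
  finally show ?thesis .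
qed

theorem theorem2p3:
  fixes f :: "real^'n \<Rightarrow> real" and x v :: "real^'n"
  assumes "twice_cont_differentiable f"
    and "0 \<le> x"
    and "\<And>i. v $ i = sqrt (x $ i) \<or> v $ i = - sqrt (x $ i)"
  shows "weak_second_order_necessary_BC f x \<longleftrightarrow>
         second_order_necessary_unconstrained (DSS_objective f) v"
proof -
  let ?F = "DSS_objective f" and ?g = "gradient f x" and ?H = "hessian f x"
  have diff: "\<And>y. f differentiable (at y)" and diff2: "\<And>y. gradient f differentiable (at y)"
    using assms(1) by (auto simp: twice_cont_differentiable_def)
  have x_nonneg: "0 \<le> x $ i" for i
    using assms(2) by (simp add: less_eq_vec_def)
  have x_eq: "x $ i = v $ i * v $ i" for i
    using assms(3) [of i] x_nonneg [of i] by auto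
  have vv: "v * v = x"
    by (simp add: vec_eq_iff x_eq)
  have v_0_iff: "v $ i = 0 \<longleftrightarrow> x $ i = 0" for i
    by (simp add: x_eq)
  have grad: "gradient ?F v = 0 \<longleftrightarrow> (\<forall>i. x $ i * ?g $ i = 0)"
    using gradient_DSS_objective [of f v, OF diff] by (simp add: vv vec_eq_iff v_0_iff)
  have quad: "w \<bullet> (hessian ?F v *v w) =
      2 * (\<Sum>i\<in>UNIV. ?g $ i * (w $ i)\<^sup>2) + 4 * ((v * w) \<bullet> (?H *v (v * w)))" for w
    using hessian_DSS_objective_quadratic_form [OF diff diff2, of w v] by (simp add: vv)
  show ?thesis
  proof
    assume weak: "weak_second_order_necessary_BC f x"
    then have g_nonneg: "0 \<le> ?g $ i" and compl: "x $ i * ?g $ i = 0" for i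
      by (auto simp: weak_second_order_necessary_BC_def first_order_necessary_BC_def less_eq_vec_def)
    have "0 \<le> w \<bullet> (hessian ?F v *v w)" for w
    proof -
      have "\<forall>i \<in> active_set f x \<union> degenerate_set f x. (v * w) $ i = 0"
        by (auto simp: active_set_def degenerate_set_def v_0_iff)
      then have "0 \<le> (v * w) \<bullet> (?H *v (v * w))"
        using weak unfolding weak_second_order_necessary_BC_def by blast
      then show ?thesis
        unfolding quad by (intro add_nonneg_nonneg mult_nonneg_nonneg sum_nonneg) (auto simp: g_nonneg)
    qed
    then show "second_order_necessary_unconstrained ?F v"
      unfolding second_order_necessary_unconstrained_def pos_semidef_def grad using compl by blast
  next
    assume "second_order_necessary_unconstrained ?F v"
    then have compl: "x $ i * ?g $ i = 0" and psd: "0 \<le> w \<bullet> (hessian ?F v *v w)" for i w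
      by (simp_all add: second_order_necessary_unconstrained_def pos_semidef_def grad)
    have g_nonneg: "0 \<le> ?g $ i" for i
    proof (cases "x $ i = 0")
      case True
      have "v * axis i 1 = 0"
        using True by (auto simp: vec_eq_iff axis_def v_0_iff)
      moreover have "(\<Sum>j\<in>UNIV. ?g $ j * (axis i 1 $ j)\<^sup>2) = ?g $ i"
        by (simp add: axis_def if_distrib [of "\<lambda>t. t\<^sup>2"] if_distrib [of "(*) _"] cong: if_cong)
      ultimately show ?thesis
        using psd [of "axis i 1"] by (simp add: quad)
    next
      case False
      then show ?thesis
        using compl [of i] by simp
    qed
    have "0 \<le> u \<bullet> (?H *v u)"
      if u: "\<forall>i \<in> active_set f x \<union> degenerate_set f x. u $ i = 0" for u
    proof -
      have u_0: "u $ i = 0" if "x $ i = 0" for i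
        using u that g_nonneg [of i] by (force simp: active_set_def degenerate_set_def)
      \<comment> \<open>Where \<open>v\<close> vanishes, so does \<open>u\<close>, and the convention \<open>0 / 0 = 0\<close> gives the right value.\<close>
      define w where "w = (\<chi> i. u $ i / v $ i)"
      have "v * w = u"
        by (auto simp: w_def vec_eq_iff v_0_iff u_0)
      moreover have "(\<Sum>i\<in>UNIV. ?g $ i * (w $ i)\<^sup>2) = 0"
      proof (intro sum.neutral ballI)
        show "?g $ i * (w $ i)\<^sup>2 = 0" for i
          using compl [of i] by (auto simp: w_def u_0)
      qed
      ultimately show ?thesis
        using psd [of w] by (simp add: quad)
    qed
    then show "weak_second_order_necessary_BC f x"
      using assms(2) compl g_nonneg
      by (auto simp: weak_second_order_necessary_BC_def first_order_necessary_BC_def less_eq_vec_def)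
  qed
qed

end
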